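(* Let $K$ be a countable compact metric space. Then the Banach space $C(K)$ has an Auerbach basis.
   Context: Scalars are real. $C(K)$ is the space of continuous scalar-valued functions on $K$ with the supremum norm. For a separable Banach space $X$, an Auerbach basis of $X$ is a sequence of pairs $(x_n;x_n^* )_{n}$ (infinite if $X$ is infinite-dimensional, finite if $X$ is finite-dimensional) with $x_n\in X$ and $x_n^*\in X^*$ (the continuous dual, with the dual norm) such that: (1) (biorthogonal) $x_k^*(x_j)=\delta_{k,j}$ for all $k,j$; (2) (total) if $x\in X$ and $x_n^*(x)=0$ for every $n$, then $x=0$; (3) (fundamental) the closed linear span of $\{x_n\}_n$ is $X$; (4) $\|x_n\|=\|x_n^*\|=1$ for every $n$. *)

theory Defs
  imports "HOL-Analysis.Analysis"
begin

(* For compact K = UNIV, every continuous function is bounded, so the library type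
   of bounded continuous functions with its supremum norm is C(K). *)
instance bcontfun :: (metric_space, banach) banach ..

definition finite_dim_space :: "'x::real_vector itself \<Rightarrow> bool" where
  "finite_dim_space _ \<longleftrightarrow> (\<exists>B :: 'x set. finite B \<and> span B = UNIV)"

(* The sequence of pairs (x n; f n) is indexed by an initial segment I of the naturals: all of nat
   if the space is infinite-dimensional, {..<n} for some n otherwise (values outside I are
   irrelevant).  Separability of the space is implied by the density of the span. *)
definition auerbach_basis ::
  "nat set \<Rightarrow> (nat \<Rightarrow> 'x::banach) \<Rightarrow> (nat \<Rightarrow> 'x \<Rightarrow>\<^sub>L real) \<Rightarrow> bool" where
  "auerbach_basis I x f \<longleftrightarrow>
     (if finite_dim_space TYPE('x) then (\<exists>n. I = {..<n}) else I = UNIV) \<and>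
     (\<forall>k\<in>I. \<forall>j\<in>I. blinfun_apply (f k) (x j) = (if k = j then 1 else 0)) \<and>
     (\<forall>y. (\<forall>n\<in>I. blinfun_apply (f n) y = 0) \<longrightarrow> y = 0) \<and>
     closure (span (x ` I)) = UNIV \<and>
     (\<forall>n\<in>I. norm (x n) = 1 \<and> norm (f n) = 1)"

definition has_auerbach_basis :: "'x::banach itself \<Rightarrow> bool" where
  "has_auerbach_basis _ \<longleftrightarrow>
     (\<exists>I (x :: nat \<Rightarrow> 'x) (f :: nat \<Rightarrow> 'x \<Rightarrow>\<^sub>L real). auerbach_basis I x f)"

end

theory Submission
  imports Defs
begin

text \<open>
  A countable compact metric space has a sequence of clopen sets \<open>C\<^sub>0, C\<^sub>1, \<dots>\<close> generating its
  topology. Cutting the space successively along the \<open>C\<^sub>n\<close> yields a binary tree of clopen cells.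
  Let \<open>\<mu>\<close> be the probability measure that divides the mass of a cell equally whenever
  the cell is cut into two nonempty halves. The constant 1 and the functions \<open>1\<^sub>L - 1\<^sub>R\<close>, for all
  cut cells with halves \<open>L\<close> and \<open>R\<close>, form the Haar system of \<open>\<mu>\<close>; the biorthogonal functionals are
  \<open>\<mu>\<close> and half the difference of the \<open>\<mu>\<close>-means over \<open>L\<close> and \<open>R\<close>, which have norm 1 because the
  two halves have equal mass. The functionals are total since every cell has positive mass, and the
  functions are fundamental since every continuous function is almost constant on all sufficiently
  deep cells.
\<close>

section \<open>Reduction to biorthogonal systems over a countable index set\<close>

text \<open>Enumerating \<open>J\<close> by an initial segment of the naturals transfers everything
  except the link between dimension and index set. For that, biorthogonality makes \<open>x\<close>
  injective with independent image, so finite dimension forces \<open>J\<close> finite; conversely,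
  for finite \<open>J\<close> totality makes every vector equal to its expansion.\<close>

lemma has_auerbach_basisI:
  fixes x :: "'i \<Rightarrow> 'x::banach" and f :: "'i \<Rightarrow> 'x \<Rightarrow>\<^sub>L real"
  assumes J: "countable J"
    and bi: "\<And>k j. k \<in> J \<Longrightarrow> j \<in> J \<Longrightarrow> f k (x j) = (if k = j then 1 else 0)"
    and total: "\<And>y. (\<And>k. k \<in> J \<Longrightarrow> f k y = 0) \<Longrightarrow> y = 0"
    and fund: "closure (span (x ` J)) = UNIV"
    and norms: "\<And>k. k \<in> J \<Longrightarrow> norm (x k) = 1" "\<And>k. k \<in> J \<Longrightarrow> norm (f k) = 1"
  shows "has_auerbach_basis TYPE('x)"
proof -
  have inj: "inj_on x J"
    by (rule inj_onI) (metis bi zero_neq_one)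
  have indep: "independent (x ` J)"
    unfolding dependent_def
  proof clarify
    fix k assume k: "k \<in> J" "x k \<in> span (x ` J - {x k})"
    \<comment> \<open>\<open>f k\<close> kills the span of the other vectors, whereas
      \<open>f k (x k) = 1\<close>.\<close>
    have "f k y = 0" if "y \<in> span (x ` J - {x k})" for y
      using that
    proof (induction rule: span_induct_alt)
      case base
      then show ?case by simp
    next
      case (step c b y)
      then show ?case using bi[OF k(1)] by (auto simp: blinfun.add_right blinfun.scaleR_right split: if_splits)
    qed
    then show False using bi k by fastforce
  qed
  have fin: "finite_dim_space TYPE('x) \<longleftrightarrow> finite J"
  proof
    assume "finite_dim_space TYPE('x)"
    then obtain B :: "'x set" where "finite B" "span B = UNIV"
      unfolding finite_dim_space_def by blast
    then have "finite (x ` J)"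
      using independent_span_bound[OF _ indep] by blast
    then show "finite J" using inj finite_imageD by blast
  next
    assume fJ: "finite J"
    have "y \<in> span (x ` J)" for y
    proof -
      \<comment> \<open>Every functional of the system vanishes on the difference between
        \<open>y\<close> and its expansion.\<close>
      have "y - (\<Sum>j\<in>J. f j y *\<^sub>R x j) = 0"
      proof (rule total)
        fix k assume k: "k \<in> J"
        have "f k (\<Sum>j\<in>J. f j y *\<^sub>R x j) = (\<Sum>j\<in>J. f j y * (if k = j then 1 else 0))"
          using bi k by (simp add: blinfun.sum_right blinfun.scaleR_right)
        also have "\<dots> = f k y" using k fJ by (simp add: if_distrib cong: if_cong)
        finally show "f k (y - (\<Sum>j\<in>J. f j y *\<^sub>R x j)) = 0"
          by (simp add: blinfun.diff_right)
      qed
      then have "y = (\<Sum>j\<in>J. f j y *\<^sub>R x j)" by simp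
      moreover have "(\<Sum>j\<in>J. f j y *\<^sub>R x j) \<in> span (x ` J)"
        by (intro span_sum span_scale span_base) auto
      ultimately show ?thesis by simp
    qed
    then show "finite_dim_space TYPE('x)"
      unfolding finite_dim_space_def using fJ by blast
  qed
  obtain I and h :: "nat \<Rightarrow> 'i"
    where h: "bij_betw h I J" and I: "if finite J then \<exists>n. I = {..<n} else I = UNIV"
  proof (cases "finite J")
    case True
    then show ?thesis
      using ex_bij_betw_nat_finite[OF True] that by (auto simp: atLeast0LessThan)
  next
    case False
    then show ?thesis
      using bij_betw_from_nat_into[OF J] that by auto
  qed
  have hJ: "h n \<in> J" if "n \<in> I" for n
    using h that by (auto simp: bij_betw_def)
  have hinj: "h n = h m \<longleftrightarrow> n = m" if "n \<in> I" "m \<in> I" for n m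
    using h that by (auto simp: bij_betw_def inj_on_eq_iff)
  have himg: "h ` I = J" using h by (simp add: bij_betw_def)
  have "auerbach_basis I (\<lambda>n. x (h n)) (\<lambda>n. f (h n))"
    unfolding auerbach_basis_def fin
  proof (intro conjI ballI allI impI)
    fix y assume "\<forall>n\<in>I. f (h n) y = 0"
    then show "y = 0" using himg by (intro total) auto
  next
    show "closure (span ((\<lambda>n. x (h n)) ` I)) = UNIV"
      using fund by (simp add: himg[symmetric] image_image)
  qed (use I in \<open>auto simp: bi hJ hinj norms\<close>)
  then show ?thesis unfolding has_auerbach_basis_def by blast
qed

section \<open>Indicators of clopen sets as elements of C(K)\<close>

text \<open>\<open>Bcontfun\<close> gives the intended function only if the indicator is continuous,
  that is, for clopen \<open>A\<close>.\<close>

definition indicator_bcontfun :: "'a::metric_space set \<Rightarrow> 'a \<Rightarrow>\<^sub>C real" where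
  "indicator_bcontfun A = Bcontfun (indicator A)"

lemma apply_indicator_bcontfun:
  assumes "open A" "closed A"
  shows "apply_bcontfun (indicator_bcontfun A) = indicator A"
proof -
  have "continuous_on UNIV (indicator A :: 'a \<Rightarrow> real)"
  proof (subst continuous_on_open_vimage[OF open_UNIV], intro allI impI)
    fix U :: "real set"
    have "indicator A -` U \<inter> UNIV = (if 1 \<in> U then A else {}) \<union> (if 0 \<in> U then - A else {})"
      by (auto simp: indicator_def of_bool_def split: if_splits)
    then show "open (indicator A -` U \<inter> UNIV)"
      using assms by (simp add: open_Compl)
  qed
  moreover have "bounded (range (indicator A :: 'a \<Rightarrow> real))"
    by (rule boundedI[where B = 1]) (auto simp: indicator_def)
  ultimately show ?thesis
    unfolding indicator_bcontfun_def by (intro Bcontfun_inverse) (simp add: bcontfun_def)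
qed

section \<open>The tree of clopen cells\<close>

text \<open>\<open>small_oscillation\<close> is a uniform form of the statement that the sets
  \<open>C n\<close> generate the topology: membership in finitely many of them determines the
  values of \<open>y\<close> up to \<open>e\<close>. Compactness and countability of the space enter
  through the existence of such a sequence.\<close>

locale clopen_sequence =
  fixes C :: "nat \<Rightarrow> 'a::metric_space set"
  assumes open_C: "open (C n)" and closed_C: "closed (C n)"
    and small_oscillation: "\<And>(y :: 'a \<Rightarrow>\<^sub>C real) e. 0 < e \<Longrightarrow>
      \<exists>n. \<forall>x x'. (\<forall>i<n. x \<in> C i \<longleftrightarrow> x' \<in> C i) \<longrightarrow> \<bar>apply_bcontfun y x - apply_bcontfun y x'\<bar> \<le> e"
begin

definition cell :: "nat \<Rightarrow> 'a \<Rightarrow> 'a set" where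
  "cell n x = {x'. \<forall>i<n. x' \<in> C i \<longleftrightarrow> x \<in> C i}"

definition cells :: "nat \<Rightarrow> 'a set set" where
  "cells n = range (cell n)"

text \<open>A cell of level \<open>n\<close> that is not cut by \<open>C n\<close> is again a cell
  of level \<open>Suc n\<close>. One set may thus be a cell of several levels, so the level is
  carried along as a separate argument below.\<close>

definition cut :: "nat \<Rightarrow> 'a set \<Rightarrow> bool" where
  "cut n A \<longleftrightarrow> A \<inter> C n \<noteq> {} \<and> A - C n \<noteq> {}"

lemma cell_0: "cell 0 x = UNIV"
  by (simp add: cell_def)

lemma cell_Suc: "cell (Suc n) x = (if x \<in> C n then cell n x \<inter> C n else cell n x - C n)"
  by (auto simp: cell_def less_Suc_eq)

lemma self_in_cell: "x \<in> cell n x"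
  by (simp add: cell_def)

lemma cell_eqI: "x' \<in> cell n x \<Longrightarrow> cell n x' = cell n x"
  by (auto simp: cell_def)

lemma cells_eq_cell: "A \<in> cells n \<Longrightarrow> x \<in> A \<Longrightarrow> A = cell n x"
  by (auto simp: cells_def dest: cell_eqI)

lemma cells_nonempty: "A \<in> cells n \<Longrightarrow> A \<noteq> {}"
  using self_in_cell by (auto simp: cells_def)

lemma cells_0: "cells 0 = {UNIV}"
  by (auto simp: cells_def cell_0)

lemma cells_disjoint: "A \<in> cells n \<Longrightarrow> B \<in> cells n \<Longrightarrow> A \<noteq> B \<Longrightarrow> A \<inter> B = {}"
  using cells_eq_cell by blast

lemma cut_cells:
  assumes "A \<in> cells n" "cut n A"
  shows "A \<inter> C n \<in> cells (Suc n)" "A - C n \<in> cells (Suc n)"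
proof -
  obtain p q where pq: "p \<in> A" "p \<in> C n" "q \<in> A" "q \<notin> C n"
    using assms(2) unfolding cut_def by blast
  then have "A \<inter> C n = cell (Suc n) p" "A - C n = cell (Suc n) q"
    using cells_eq_cell[OF assms(1)] by (auto simp: cell_Suc)
  then show "A \<inter> C n \<in> cells (Suc n)" "A - C n \<in> cells (Suc n)"
    by (auto simp: cells_def)
qed

lemma uncut_cells:
  assumes "A \<in> cells n" "\<not> cut n A"
  shows "A \<in> cells (Suc n)"
proof -
  obtain p where p: "A = cell n p" using assms(1) by (auto simp: cells_def)
  then have "A = cell (Suc n) p"
    using assms(2) self_in_cell[of p n] by (auto simp: cell_Suc cut_def)
  then show ?thesis by (simp add: cells_def)
qed

lemma cells_SucE:
  assumes "A \<in> cells (Suc n)"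
  obtains B where "B \<in> cells n" "cut n B" "A = B \<inter> C n \<or> A = B - C n"
  | "A \<in> cells n" "\<not> cut n A"
proof -
  obtain p where p: "A = cell (Suc n) p" using assms by (auto simp: cells_def)
  have B: "cell n p \<in> cells n" by (simp add: cells_def)
  show thesis
  proof (cases "cut n (cell n p)")
    case True
    then show ?thesis using that(1)[OF B] p by (auto simp: cell_Suc)
  next
    case False
    then have "A = cell n p" using p self_in_cell[of p n] by (auto simp: cut_def cell_Suc)
    then show ?thesis using False B that(2) by simp
  qed
qed

lemma clopen_cells:
  assumes "A \<in> cells n"
  shows "open A \<and> closed A"
  using assms
proof (induction n arbitrary: A)
  case 0
  then show ?case by (simp add: cells_0)
next
  case (Suc n)
  from Suc.prems show ?case
    by (cases rule: cells_SucE)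
      (use Suc.IH open_C[of n] closed_C[of n] in \<open>auto simp: open_Int closed_Int open_Diff closed_Diff\<close>)
qed

lemma finite_cells: "finite (cells n)"
proof (induction n)
  case 0
  then show ?case by (simp add: cells_0)
next
  case (Suc n)
  have "cells (Suc n) \<subseteq> (\<lambda>B. B \<inter> C n) ` cells n \<union> (\<lambda>B. B - C n) ` cells n \<union> cells n"
    by (auto elim!: cells_SucE)
  then show ?case using Suc finite_subset by blast
qed

text \<open>Points in a common cell of level \<open>m\<close> agree on the first \<open>m\<close>
  sets, hence on the first \<open>n\<close> for every \<open>n \<le> m\<close>.\<close>

lemma cells_oscillation:
  fixes e :: real
  assumes "0 < e"
  obtains n where "\<And>m A x x'. n \<le> m \<Longrightarrow> A \<in> cells m \<Longrightarrow> x \<in> A \<Longrightarrow> x' \<in> A \<Longrightarrow>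
    \<bar>apply_bcontfun y x - apply_bcontfun y x'\<bar> \<le> e"
proof -
  obtain n where n: "\<And>x x'. (\<And>i. i < n \<Longrightarrow> x \<in> C i \<longleftrightarrow> x' \<in> C i) \<Longrightarrow>
      \<bar>apply_bcontfun y x - apply_bcontfun y x'\<bar> \<le> e"
    using small_oscillation[OF assms] by blast
  show thesis
  proof (rule that[of n], rule n)
    fix m A x x' i
    assume "n \<le> m" "A \<in> cells m" "x \<in> A" "x' \<in> A" "i < n"
    then show "x \<in> C i \<longleftrightarrow> x' \<in> C i"
      by (auto simp: cells_def cell_def)
  qed
qed

section \<open>Means over cells\<close>

text \<open>The mean over the cell \<open>A\<close> of level \<open>n\<close>, with cells cut only down to level \<open>n + j\<close> and
  each resulting cell represented by a sample point.\<close>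

fun sample_mean :: "nat \<Rightarrow> nat \<Rightarrow> 'a set \<Rightarrow> ('a \<Rightarrow>\<^sub>C real) \<Rightarrow> real" where
  "sample_mean 0 n A y = apply_bcontfun y (SOME x. x \<in> A)"
| "sample_mean (Suc j) n A y =
    (if cut n A
     then (sample_mean j (Suc n) (A \<inter> C n) y + sample_mean j (Suc n) (A - C n) y) / 2
     else sample_mean j (Suc n) A y)"

text \<open>The integral of \<open>y\<close> against \<mu> conditioned on \<open>A\<close>, obtained
  as a limit of sample means in place of a measure construction. Convergence is shown for cells
  \<open>A\<close> of level \<open>n\<close>.\<close>

definition mean :: "nat \<Rightarrow> 'a set \<Rightarrow> ('a \<Rightarrow>\<^sub>C real) \<Rightarrow> real" where
  "mean n A y = lim (\<lambda>j. sample_mean j n A y)"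

lemma sample_mean_bounds:
  assumes "A \<in> cells n" "\<And>x. x \<in> A \<Longrightarrow> a \<le> apply_bcontfun y x \<and> apply_bcontfun y x \<le> b"
  shows "a \<le> sample_mean j n A y \<and> sample_mean j n A y \<le> b"
  using assms
proof (induction j arbitrary: n A)
  case 0
  then show ?case using cells_nonempty[OF 0(1)] some_in_eq[of A] by auto
next
  case (Suc j)
  show ?case
  proof (cases "cut n A")
    case True
    note cc = cut_cells[OF Suc.prems(1) True]
    have "a \<le> sample_mean j (Suc n) (A \<inter> C n) y \<and> sample_mean j (Suc n) (A \<inter> C n) y \<le> b"
      using Suc.prems(2) by (intro Suc.IH cc) auto
    moreover have "a \<le> sample_mean j (Suc n) (A - C n) y \<and> sample_mean j (Suc n) (A - C n) y \<le> b"
      using Suc.prems(2) by (intro Suc.IH cc) auto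
    ultimately show ?thesis using True by auto
  next
    case False
    then show ?thesis using Suc.IH[OF uncut_cells[OF Suc.prems(1) False] Suc.prems(2)] by simp
  qed
qed

text \<open>Both sample means unfold by the same recursion, and averaging does not increase the
  error. Once level \<open>N\<close> is reached, each is within \<open>e\<close> of the value of
  \<open>y\<close> at one common point, whence \<open>2 * e\<close>.\<close>

lemma sample_mean_close:
  assumes osc: "\<And>m A x x'. N \<le> m \<Longrightarrow> A \<in> cells m \<Longrightarrow> x \<in> A \<Longrightarrow> x' \<in> A \<Longrightarrow>
      \<bar>apply_bcontfun y x - apply_bcontfun y x'\<bar> \<le> e"
    and "A \<in> cells n" "N \<le> n + j" "N \<le> n + k"
  shows "\<bar>sample_mean j n A y - sample_mean k n A y\<bar> \<le> 2 * e"
proof -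
  have deep: "\<bar>sample_mean j n A y - sample_mean k n A y\<bar> \<le> 2 * e"
    if "N \<le> n" "A \<in> cells n" for n A j k
  proof -
    obtain p where p: "p \<in> A" using cells_nonempty[OF \<open>A \<in> cells n\<close>] by blast
    have *: "apply_bcontfun y p - e \<le> apply_bcontfun y x \<and>
        apply_bcontfun y x \<le> apply_bcontfun y p + e" if "x \<in> A" for x
      using osc[OF \<open>N \<le> n\<close> \<open>A \<in> cells n\<close> that p] by linarith
    show ?thesis
      using sample_mean_bounds[OF that(2) *, of j] sample_mean_bounds[OF that(2) *, of k]
      by linarith
  qed
  show ?thesis
    using assms(2-4)
  proof (induction j arbitrary: n k A)
    case 0
    then show ?case by (intro deep) auto
  next
    case (Suc j)
    show ?case
    proof (cases k)
      case 0
      then show ?thesis using Suc.prems by (intro deep) auto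
    next
      case k: (Suc k')
      note IH = Suc.IH[where n = "Suc n" and k = k']
      show ?thesis
      proof (cases "cut n A")
        case True
        then show ?thesis
          using IH[OF cut_cells(1)[OF Suc.prems(1) True]]
            IH[OF cut_cells(2)[OF Suc.prems(1) True]] Suc.prems
          by (simp add: k abs_le_iff field_simps)
      next
        case False
        then show ?thesis using IH[OF uncut_cells[OF Suc.prems(1) False]] Suc.prems
          by (simp add: k)
      qed
    qed
  qed
qed

lemma sample_mean_tendsto:
  assumes "A \<in> cells n"
  shows "(\<lambda>j. sample_mean j n A y) \<longlonglongrightarrow> mean n A y"
proof -
  have "Cauchy (\<lambda>j. sample_mean j n A y)"
  proof (rule metric_CauchyI)
    fix e :: real assume "0 < e"
    then have "0 < e / 3" by simp
    then obtain N where N: "\<And>m A x x'. N \<le> m \<Longrightarrow> A \<in> cells m \<Longrightarrow> x \<in> A \<Longrightarrow> x' \<in> A \<Longrightarrow>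
        \<bar>apply_bcontfun y x - apply_bcontfun y x'\<bar> \<le> e / 3"
      using cells_oscillation[where y = y] by blast
    show "\<exists>M. \<forall>j\<ge>M. \<forall>k\<ge>M. dist (sample_mean j n A y) (sample_mean k n A y) < e"
    proof (intro exI allI impI)
      fix j k assume "N \<le> j" "N \<le> k"
      then have "\<bar>sample_mean j n A y - sample_mean k n A y\<bar> \<le> 2 * (e / 3)"
        by (intro sample_mean_close[OF N assms]) auto
      then show "dist (sample_mean j n A y) (sample_mean k n A y) < e"
        using \<open>0 < e\<close> by (simp add: dist_real_def)
    qed
  qed
  then show ?thesis
    unfolding mean_def by (simp add: Cauchy_convergent_iff convergent_LIMSEQ_iff)
qed

lemma mean_bounds:
  assumes "A \<in> cells n" "\<And>x. x \<in> A \<Longrightarrow> a \<le> apply_bcontfun y x \<and> apply_bcontfun y x \<le> b"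
  shows "a \<le> mean n A y" "mean n A y \<le> b"
  using sample_mean_bounds[OF assms]
    LIMSEQ_le_const[OF sample_mean_tendsto[OF assms(1)]]
    LIMSEQ_le_const2[OF sample_mean_tendsto[OF assms(1)]] by blast+

lemma mean_const:
  assumes "A \<in> cells n" "\<And>x. x \<in> A \<Longrightarrow> apply_bcontfun y x = c"
  shows "mean n A y = c"
  using mean_bounds[OF assms(1), of c y c] assms(2) by force

text \<open>One unfolding of the recursion, passed to the limit. The equal weights express that
  \<mu> gives both halves the same mass.\<close>

lemma mean_cut:
  assumes "A \<in> cells n" "cut n A"
  shows "mean n A y = (mean (Suc n) (A \<inter> C n) y + mean (Suc n) (A - C n) y) / 2"
proof (rule LIMSEQ_unique)
  show "(\<lambda>j. sample_mean (Suc j) n A y) \<longlonglongrightarrow> mean n A y"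
    by (rule LIMSEQ_Suc[OF sample_mean_tendsto[OF assms(1)]])
  show "(\<lambda>j. sample_mean (Suc j) n A y) \<longlonglongrightarrow>
      (mean (Suc n) (A \<inter> C n) y + mean (Suc n) (A - C n) y) / 2"
    using assms by (auto intro!: tendsto_intros sample_mean_tendsto cut_cells)
qed

lemma mean_uncut:
  assumes "A \<in> cells n" "\<not> cut n A"
  shows "mean n A y = mean (Suc n) A y"
proof (rule LIMSEQ_unique)
  show "(\<lambda>j. sample_mean (Suc j) n A y) \<longlonglongrightarrow> mean n A y"
    by (rule LIMSEQ_Suc[OF sample_mean_tendsto[OF assms(1)]])
  show "(\<lambda>j. sample_mean (Suc j) n A y) \<longlonglongrightarrow> mean (Suc n) A y"
    using assms by (auto intro!: sample_mean_tendsto uncut_cells)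
qed

text \<open>The sample points depend on the cells and not on the function, so additivity is exact at
  every depth.\<close>

lemma sample_mean_add: "sample_mean j n A (y + z) = sample_mean j n A y + sample_mean j n A z"
  by (induction j n A y rule: sample_mean.induct) (auto simp: field_simps)

lemma sample_mean_scaleR: "sample_mean j n A (c *\<^sub>R y) = c * sample_mean j n A y"
  by (induction j n A y rule: sample_mean.induct) (auto simp: field_simps)

lemma abs_mean_le:
  assumes "A \<in> cells n"
  shows "\<bar>mean n A y\<bar> \<le> norm y"
proof -
  have "- norm y \<le> apply_bcontfun y x \<and> apply_bcontfun y x \<le> norm y" for x
    using norm_bounded[of y x] by (simp add: abs_le_iff)
  from mean_bounds[OF assms this] show ?thesis by linarith
qed

lemma bounded_linear_mean:
  assumes "A \<in> cells n"
  shows "bounded_linear (mean n A)"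
proof (rule bounded_linear_intro)
  note lim = sample_mean_tendsto[OF assms]
  show "mean n A (y + z) = mean n A y + mean n A z" for y z
    using LIMSEQ_unique[OF lim[of "y + z"]] tendsto_add[OF lim[of y] lim[of z]]
    by (simp add: sample_mean_add)
  show "mean n A (c *\<^sub>R y) = c *\<^sub>R mean n A y" for c y
    using LIMSEQ_unique[OF lim[of "c *\<^sub>R y"]] tendsto_mult_left[OF lim[of y], of c]
    by (simp add: sample_mean_scaleR)
  show "norm (mean n A y) \<le> norm y * 1" for y
    using abs_mean_le[OF assms] by simp
qed

section \<open>The Haar system and its dual functionals\<close>

text \<open>\<open>None\<close> stands for the constant function 1, \<open>Some (n, A)\<close> for
  the cell \<open>A\<close> of level \<open>n\<close> cut by \<open>C n\<close>.\<close>

definition haar_index :: "(nat \<times> 'a set) option set" where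
  "haar_index = insert None (Some ` (SIGMA n:UNIV. {A \<in> cells n. cut n A}))"

definition haar :: "nat \<Rightarrow> 'a set \<Rightarrow> 'a \<Rightarrow>\<^sub>C real" where
  "haar n A = indicator_bcontfun (A \<inter> C n) - indicator_bcontfun (A - C n)"

fun haar_fun :: "(nat \<times> 'a set) option \<Rightarrow> 'a \<Rightarrow>\<^sub>C real" where
  "haar_fun None = indicator_bcontfun UNIV"
| "haar_fun (Some (n, A)) = haar n A"

text \<open>The means of \<open>haar n A\<close> over the two halves are 1 and -1, so the factor 1/2
  gives the coefficient 1; it also keeps the norm at most 1.\<close>

definition haar_coeff :: "nat \<Rightarrow> 'a set \<Rightarrow> ('a \<Rightarrow>\<^sub>C real) \<Rightarrow> real" where
  "haar_coeff n A y = (mean (Suc n) (A \<inter> C n) y - mean (Suc n) (A - C n) y) / 2"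

fun haar_dual :: "(nat \<times> 'a set) option \<Rightarrow> ('a \<Rightarrow>\<^sub>C real) \<Rightarrow>\<^sub>L real" where
  "haar_dual None = Blinfun (mean 0 UNIV)"
| "haar_dual (Some (n, A)) = Blinfun (haar_coeff n A)"

lemma haar_index_cases:
  assumes "k \<in> haar_index"
  obtains "k = None" | n A where "k = Some (n, A)" "A \<in> cells n" "cut n A"
  using assms by (auto simp: haar_index_def)

lemma apply_haar:
  assumes "A \<in> cells n"
  shows "apply_bcontfun (haar n A) x = indicator (A \<inter> C n) x - indicator (A - C n) x"
  using clopen_cells[OF assms] open_C[of n] closed_C[of n]
  by (simp add: haar_def apply_indicator_bcontfun open_Int closed_Int open_Diff closed_Diff)

lemma haar_dual_None: "haar_dual None y = mean 0 UNIV y"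
  by (simp add: bounded_linear_Blinfun_apply bounded_linear_mean cells_0)

lemma haar_dual_Some:
  assumes "A \<in> cells n" "cut n A"
  shows "haar_dual (Some (n, A)) y = haar_coeff n A y"
proof -
  have "bounded_linear (\<lambda>y. (mean (Suc n) (A \<inter> C n) y - mean (Suc n) (A - C n) y) / 2)"
    using assms
    by (intro bounded_linear_compose[OF bounded_linear_divide] bounded_linear_sub
        bounded_linear_mean cut_cells)
  then show ?thesis
    by (simp add: haar_coeff_def[abs_def] bounded_linear_Blinfun_apply)
qed

section \<open>Biorthogonality and norms\<close>

text \<open>At level \<open>m\<close> the values 1 and -1 cancel over \<open>B\<close>, and every
  other cell misses \<open>B\<close>. Means over coarser cells are averages of these zeros, which
  gives an induction from level \<open>m\<close> up the tree to level \<open>n\<close>.\<close>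

lemma mean_haar:
  assumes "B \<in> cells m" "cut m B" "A \<in> cells n" "n \<le> m"
  shows "mean n A (haar m B) = 0"
  using assms(4,3)
proof (induction n arbitrary: A rule: inc_induct)
  case base
  show ?case
  proof (cases "A = B")
    case True
    have "mean (Suc m) (B \<inter> C m) (haar m B) = 1"
      using assms(1,2) by (intro mean_const cut_cells) (auto simp: apply_haar)
    moreover have "mean (Suc m) (B - C m) (haar m B) = - 1"
      using assms(1,2) by (intro mean_const cut_cells) (auto simp: apply_haar)
    ultimately show ?thesis using assms(1,2) True by (simp add: mean_cut)
  next
    case False
    then have "A \<inter> B = {}" using cells_disjoint assms(1) base by blast
    then show ?thesis
      using assms(1) base by (intro mean_const) (auto simp: apply_haar indicator_def)
  qed
next
  case (step n)
  then show ?case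
    by (cases "cut n A") (simp_all add: mean_cut mean_uncut cut_cells uncut_cells)
qed

lemma haar_coeff_const:
  assumes "A \<in> cells n" "cut n A" "\<And>x. x \<in> A \<Longrightarrow> apply_bcontfun y x = c"
  shows "haar_coeff n A y = 0"
  using assms mean_const[OF cut_cells(1), of A n y c] mean_const[OF cut_cells(2), of A n y c]
  by (simp add: haar_coeff_def)

text \<open>If \<open>n < m\<close>, both halves of \<open>A\<close> have level at most
  \<open>m\<close> and \<open>mean_haar\<close> applies. If \<open>n = m\<close>, the cells coincide
  or are disjoint. If \<open>n > m\<close>, the function \<open>haar m B\<close> is constant on
  \<open>A\<close>.\<close>

lemma haar_coeff_haar:
  assumes A: "A \<in> cells n" "cut n A" and B: "B \<in> cells m" "cut m B"
  shows "haar_coeff n A (haar m B) = (if n = m \<and> A = B then 1 else 0)"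
proof (cases n m rule: linorder_cases)
  case less
  then show ?thesis using A B by (simp add: haar_coeff_def mean_haar cut_cells)
next
  case equal
  show ?thesis
  proof (cases "A = B")
    case True
    have "mean (Suc n) (A \<inter> C n) (haar n A) = 1"
      using A by (intro mean_const cut_cells) (auto simp: apply_haar)
    moreover have "mean (Suc n) (A - C n) (haar n A) = - 1"
      using A by (intro mean_const cut_cells) (auto simp: apply_haar)
    ultimately show ?thesis using equal True by (simp add: haar_coeff_def)
  next
    case False
    then have "A \<inter> B = {}" using cells_disjoint A(1) B(1) equal by blast
    then have "haar_coeff n A (haar m B) = 0"
      using B(1) by (intro haar_coeff_const[OF A, of _ 0]) (auto simp: apply_haar indicator_def)
    then show ?thesis using False by simp
  qed
next
  case greater
  obtain p where p: "p \<in> A" using A(1) cells_nonempty by blast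
  have "haar_coeff n A (haar m B) = 0"
  proof (rule haar_coeff_const[OF A])
    fix x assume "x \<in> A"
    then have "x \<in> cell n p" using cells_eq_cell[OF A(1) p] by simp
    \<comment> \<open>As \<open>m < n\<close>, the points \<open>x\<close> and \<open>p\<close>
      agree on \<open>C 0\<close> up to and including \<open>C m\<close>; the sets before
      \<open>C m\<close> decide membership in \<open>B\<close>.\<close>
    then have "x \<in> B \<longleftrightarrow> p \<in> B" "x \<in> C m \<longleftrightarrow> p \<in> C m"
      using greater B(1) by (auto simp: cell_def cells_def)
    then show "apply_bcontfun (haar m B) x = apply_bcontfun (haar m B) p"
      by (simp add: apply_haar[OF B(1)] indicator_def)
  qed
  then show ?thesis using greater by simp
qed

lemma apply_indicator_UNIV: "apply_bcontfun (indicator_bcontfun UNIV) x = 1"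
  by (simp add: apply_indicator_bcontfun)

lemma haar_biorthogonal:
  assumes "k \<in> haar_index" "j \<in> haar_index"
  shows "haar_dual k (haar_fun j) = (if k = j then 1 else 0)"
  using assms(1)
proof (cases rule: haar_index_cases)
  case 1
  from assms(2) show ?thesis
    by (cases rule: haar_index_cases)
      (auto simp: 1 haar_dual_None mean_haar mean_const cells_0 apply_indicator_UNIV
        simp del: haar_dual.simps)
next
  case (2 n A)
  from assms(2) show ?thesis
    by (cases rule: haar_index_cases)
      (use 2 in \<open>auto simp: haar_dual_Some haar_coeff_haar haar_coeff_const[of _ _ _ 1]
        apply_indicator_UNIV simp del: haar_dual.simps\<close>)
qed

lemma norm_haar_fun:
  assumes "k \<in> haar_index"
  shows "norm (haar_fun k) = 1"
proof -
  have "\<bar>apply_bcontfun (haar_fun k) x\<bar> \<le> 1" for x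
    using assms
    by (cases rule: haar_index_cases)
      (auto simp: apply_indicator_UNIV apply_haar indicator_def)
  then have "norm (haar_fun k) \<le> 1" by (intro norm_bound) simp
  moreover obtain x where "\<bar>apply_bcontfun (haar_fun k) x\<bar> = 1"
    using assms
  proof (cases rule: haar_index_cases)
    case 1
    then show ?thesis using that by (simp add: apply_indicator_UNIV)
  next
    case (2 n A)
    then obtain x where "x \<in> A \<inter> C n" by (auto simp: cut_def)
    then show ?thesis using that[of x] 2 by (simp add: apply_haar)
  qed
  then have "1 \<le> norm (haar_fun k)" using norm_bounded[of "haar_fun k" x] by simp
  ultimately show ?thesis by simp
qed

text \<open>Means have norm at most 1, hence so does half the difference of two; the value 1 is
  attained at the unit vector \<open>haar_fun k\<close>.\<close>

lemma norm_haar_dual: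
  assumes "k \<in> haar_index"
  shows "norm (haar_dual k) = 1"
proof (rule antisym)
  have "norm (haar_dual k y) \<le> 1 * norm y" for y
    using assms
  proof (cases rule: haar_index_cases)
    case 1
    then show ?thesis
      by (simp add: haar_dual_None abs_mean_le cells_0 del: haar_dual.simps)
  next
    case (2 n A)
    then show ?thesis
      using abs_mean_le[OF cut_cells(1)[OF 2(2,3)], of y]
        abs_mean_le[OF cut_cells(2)[OF 2(2,3)], of y]
      by (simp add: haar_dual_Some haar_coeff_def del: haar_dual.simps)
  qed
  then show "norm (haar_dual k) \<le> 1" by (intro norm_blinfun_bound) auto
  show "1 \<le> norm (haar_dual k)"
    using norm_blinfun[of "haar_dual k" "haar_fun k"] assms
    by (simp add: haar_biorthogonal norm_haar_fun)
qed

section \<open>Totality and fundamentality\<close>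

text \<open>All means over cells vanish, by induction on the level. A function with a nonzero value,
  however, has nonzero mean over a sufficiently deep cell around that point.\<close>

lemma haar_total:
  assumes zero: "\<And>k. k \<in> haar_index \<Longrightarrow> haar_dual k y = 0"
  shows "y = 0"
proof (rule ccontr)
  assume "y \<noteq> 0"
  have mean0: "mean n A y = 0" if "A \<in> cells n" for n A
    using that
  proof (induction n arbitrary: A)
    case 0
    then show ?case
      using zero[of None] by (simp add: haar_index_def cells_0 haar_dual_None del: haar_dual.simps)
  next
    case (Suc n)
    from Suc.prems show ?case
    proof (cases rule: cells_SucE)
      case (1 B)
      \<comment> \<open>The two halves of \<open>B\<close> have equal means, and their average is
        zero by induction, so both means vanish.\<close>
      then have "haar_coeff n B y = 0"
        using zero[of "Some (n, B)"] haar_dual_Some[of B n y] by (simp add: haar_index_def)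
      then show ?thesis
        using Suc.IH[OF 1(1)] 1 mean_cut[OF 1(1,2), of y] by (auto simp: haar_coeff_def)
    next
      case 2
      then show ?thesis using Suc.IH mean_uncut by metis
    qed
  qed
  obtain x where x: "apply_bcontfun y x \<noteq> 0"
    using \<open>y \<noteq> 0\<close> by (metis bcontfun_eqI zero_bcontfun.rep_eq)
  \<comment> \<open>With this oscillation the mean over the cell stays within half of the absolute
    value at \<open>x\<close>, hence away from 0.\<close>
  define e where "e = \<bar>apply_bcontfun y x\<bar> / 2"
  have "0 < e" using x by (simp add: e_def)
  then obtain n where n: "\<And>m A x x'. n \<le> m \<Longrightarrow> A \<in> cells m \<Longrightarrow> x \<in> A \<Longrightarrow> x' \<in> A \<Longrightarrow>
      \<bar>apply_bcontfun y x - apply_bcontfun y x'\<bar> \<le> e"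
    using cells_oscillation[where y = y] by blast
  have A: "cell n x \<in> cells n" by (simp add: cells_def)
  have "apply_bcontfun y x - e \<le> apply_bcontfun y x' \<and> apply_bcontfun y x' \<le> apply_bcontfun y x + e"
    if "x' \<in> cell n x" for x'
    using n[OF order_refl A self_in_cell that] by linarith
  from mean_bounds[OF A this] mean0[OF A] \<open>0 < e\<close> show False
    by (auto simp: e_def abs_if split: if_splits)
qed

text \<open>Starting from the constant 1, the indicators of the two halves of a cut cell are half
  the sum and half the difference of its indicator and its Haar function.\<close>

lemma indicator_cell_in_span:
  assumes "A \<in> cells n"
  shows "indicator_bcontfun A \<in> span (haar_fun ` haar_index)"
  using assms
proof (induction n arbitrary: A)
  case 0
  have "haar_fun None \<in> span (haar_fun ` haar_index)"
    by (intro span_base imageI) (simp add: haar_index_def)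
  then show ?case using 0 by (simp add: cells_0)
next
  case (Suc n)
  from Suc.prems show ?case
  proof (cases rule: cells_SucE)
    case (1 B)
    have "haar_fun (Some (n, B)) \<in> span (haar_fun ` haar_index)"
      using 1 by (intro span_base imageI) (simp add: haar_index_def)
    then have h: "haar n B \<in> span (haar_fun ` haar_index)" by simp
    note b = Suc.IH[OF 1(1)]
    have eq: "indicator_bcontfun B = indicator_bcontfun (B \<inter> C n) + indicator_bcontfun (B - C n)"
      using clopen_cells[OF 1(1)] open_C[of n] closed_C[of n]
      by (intro bcontfun_eqI) (auto simp: apply_indicator_bcontfun open_Int closed_Int open_Diff closed_Diff indicator_def)
    have "indicator_bcontfun (B \<inter> C n) = (1/2) *\<^sub>R (indicator_bcontfun B + haar n B)"
      "indicator_bcontfun (B - C n) = (1/2) *\<^sub>R (indicator_bcontfun B - haar n B)"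
      by (simp_all add: eq haar_def scaleR_2[symmetric])
    then show ?thesis using 1(3) h b by (metis span_add span_diff span_scale)
  next
    case 2
    then show ?thesis using Suc.IH by blast
  qed
qed

lemma haar_fundamental: "closure (span (haar_fun ` haar_index)) = UNIV"
proof -
  have "y \<in> closure (span (haar_fun ` haar_index))" for y
    unfolding closure_approachable
  proof (intro allI impI)
    fix e :: real assume "0 < e"
    then have "0 < e / 2" by simp
    then obtain n where n: "\<And>m A x x'. n \<le> m \<Longrightarrow> A \<in> cells m \<Longrightarrow> x \<in> A \<Longrightarrow> x' \<in> A \<Longrightarrow>
        \<bar>apply_bcontfun y x - apply_bcontfun y x'\<bar> \<le> e / 2"
      using cells_oscillation[where y = y] by blast
    \<comment> \<open>The step function that takes on each cell of level \<open>n\<close> the value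
      of \<open>y\<close> at a sample point.\<close>
    define g where "g = (\<Sum>A\<in>cells n. apply_bcontfun y (SOME x. x \<in> A) *\<^sub>R indicator_bcontfun A)"
    have g: "g \<in> span (haar_fun ` haar_index)"
      unfolding g_def by (intro span_sum span_scale indicator_cell_in_span)
    have "\<bar>apply_bcontfun (g - y) x\<bar> \<le> e / 2" for x
    proof -
      let ?A = "cell n x"
      have A: "?A \<in> cells n" by (simp add: cells_def)
      have "apply_bcontfun g x
          = (\<Sum>A\<in>cells n. apply_bcontfun y (SOME x. x \<in> A) * apply_bcontfun (indicator_bcontfun A) x)"
        unfolding g_def using finite_cells[of n]
        by (induction rule: finite_induct) auto
      \<comment> \<open>The cells of level \<open>n\<close> partition the space, so only the one
        around \<open>x\<close> contributes.\<close>
      also have "\<dots> = (\<Sum>A\<in>cells n. if A = ?A then apply_bcontfun y (SOME x. x \<in> A) else 0)"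
        using clopen_cells self_in_cell[of x n]
        by (intro sum.cong) (auto simp: apply_indicator_bcontfun indicator_def dest: cells_eq_cell)
      also have "\<dots> = apply_bcontfun y (SOME x. x \<in> ?A)"
        using A finite_cells by simp
      finally show ?thesis
        using n[OF order_refl A _ self_in_cell, of "SOME x. x \<in> ?A"]
          some_in_eq[of ?A] cells_nonempty[OF A] by simp
    qed
    then have "norm (g - y) \<le> e / 2" by (intro norm_bound) simp
    then show "\<exists>z\<in>span (haar_fun ` haar_index). dist z y < e"
      using g \<open>0 < e\<close> by (intro bexI[of _ g]) (auto simp: dist_norm)
  qed
  then show ?thesis by blast
qed

lemma countable_haar_index: "countable haar_index"
  unfolding haar_index_def
  by (intro countable_insert countable_image countable_SIGMA)
    (auto intro: countable_finite finite_subset[OF _ finite_cells])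

lemma has_auerbach_basis: "has_auerbach_basis TYPE('a \<Rightarrow>\<^sub>C real)"
  by (rule has_auerbach_basisI[OF countable_haar_index haar_biorthogonal haar_total
        haar_fundamental norm_haar_fun norm_haar_dual])

end

section \<open>Clopen balls in a countable compact metric space\<close>

text \<open>Only countably many numbers are distances from \<open>x\<close>. For any other radius
  the sphere is empty, so the open and the closed ball coincide.\<close>

lemma clopen_ball_exists:
  fixes x :: "'k::metric_space"
  assumes "countable (UNIV :: 'k set)" "0 < e"
  obtains r where "0 < r" "r < e" "closed (ball x r)"
proof -
  have "uncountable {0<..<e}" using assms(2) by (simp add: uncountable_open_interval)
  then obtain r where r: "r \<in> {0<..<e}" "r \<notin> range (dist x)"
    using assms(1) by (metis countable_image countable_subset subsetI)
  then have "ball x r = cball x r" by (auto simp: less_le)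
  then show thesis using r that by (metis closed_cball greaterThanLessThan_iff)
qed

theorem theorem3p4:
  assumes "compact (UNIV :: 'k::metric_space set)"
    and "countable (UNIV :: 'k set)"
  shows "has_auerbach_basis TYPE('k \<Rightarrow>\<^sub>C real)"
proof -
  have "\<forall>x n. \<exists>r. 0 < r \<and> r < inverse (real (Suc n)) \<and> closed (ball (x :: 'k) r)"
  proof (intro allI)
    fix x :: 'k and n
    show "\<exists>r. 0 < r \<and> r < inverse (real (Suc n)) \<and> closed (ball x r)"
      using clopen_ball_exists[OF assms(2), of "inverse (real (Suc n))" x] by auto
  qed
  then obtain r where r: "\<And>(x::'k) n. 0 < r x n" "\<And>x n. r x n < inverse (Suc n)"
      "\<And>x n. closed (ball x (r x n))"
    by metis
  define \<C> where "\<C> = range (\<lambda>(x, n). ball x (r x n))"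
  have "countable (UNIV :: ('k \<times> nat) set)"
    using assms(2) by (metis UNIV_Times_UNIV countable_SIGMA countableI_type)
  \<comment> \<open>\<open>\<C>\<close> is countable and nonempty, so the enumeration hits exactly
    its members, possibly with repetitions.\<close>
  then have range: "range (from_nat_into \<C>) = \<C>"
    unfolding \<C>_def by (intro range_from_nat_into) auto
  interpret clopen_sequence "from_nat_into \<C>"
  proof
    have *: "from_nat_into \<C> n \<in> \<C>" for n using range by blast
    show "open (from_nat_into \<C> n)" "closed (from_nat_into \<C> n)" for n
      using *[of n] r(3) by (auto simp: \<C>_def)
    fix e :: real and y :: "'k \<Rightarrow>\<^sub>C real"
    assume "0 < e"
    have "uniformly_continuous_on UNIV (apply_bcontfun y)"
      using assms(1) by (intro compact_uniformly_continuous) auto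
    then obtain d where d: "0 < d" "\<And>x x'. dist x' x < d \<Longrightarrow> \<bar>apply_bcontfun y x' - apply_bcontfun y x\<bar> < e"
      unfolding uniformly_continuous_on_def dist_real_def using \<open>0 < e\<close> by (metis UNIV_I)
    \<comment> \<open>Two points in a common ball of radius below \<open>d / 2\<close> are less than
      \<open>d\<close> apart.\<close>
    obtain n where n: "inverse (Suc n) < d / 2"
      using d(1) reals_Archimedean[of "d / 2"] by auto
    obtain S where S: "finite S" "UNIV = (\<Union>x\<in>S. ball x (r x n))"
      using compactE_image[OF assms(1), of UNIV "\<lambda>x. ball x (r x n)"] r(1)
      by (metis (no_types, lifting) UNIV_I UN_I centre_in_ball open_ball subsetI top.extremum_uniqueI)
    have "\<exists>i. from_nat_into \<C> i = ball x (r x n)" for x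
      using range unfolding \<C>_def by (metis (mono_tags, lifting) case_prod_conv rangeE rangeI)
    then obtain i where i: "\<And>x. from_nat_into \<C> (i x) = ball x (r x n)" by metis
    \<comment> \<open>All balls of the finite cover occur among the first \<open>N\<close> sets, so
      points not separated by these sets share a ball of the cover.\<close>
    obtain N where N: "\<And>x. x \<in> S \<Longrightarrow> i x < N"
      using finite_nat_bounded[OF finite_imageI[OF S(1), of i]] by auto
    have "\<bar>apply_bcontfun y x - apply_bcontfun y x'\<bar> \<le> e"
      if "\<forall>j<N. x \<in> from_nat_into \<C> j \<longleftrightarrow> x' \<in> from_nat_into \<C> j" for x x'
    proof -
      obtain s where s: "s \<in> S" "x \<in> ball s (r s n)" using S(2) by blast
      then have "x' \<in> ball s (r s n)" using that N i by metis
      then have "dist x x' < d"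
        using s(2) r(2)[of s n] n dist_triangle2[of x x' s] by (auto simp: dist_commute)
      then show ?thesis using d(2) less_imp_le by blast
    qed
    then show "\<exists>n. \<forall>x x'. (\<forall>j<n. x \<in> from_nat_into \<C> j \<longleftrightarrow> x' \<in> from_nat_into \<C> j) \<longrightarrow>
        \<bar>apply_bcontfun y x - apply_bcontfun y x'\<bar> \<le> e"
      by blast
  qed
  show ?thesis by (rule has_auerbach_basis)
qed

end
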